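(* For every $n\ge3$, the Laplacian simplex $\mathcal{P}_{\mathcal{W}^*(K_n)}$ is reflexive.
   Context: $K_n$ is the complete graph on $[n]$; $\mathcal{W}^*(K_n)$ is the graph on $[2n+1]$ whose edges are those of $K_n$, the edges $\{i,i+n\}$ for $i\in[n]$, and the edges $\{i,2n+1\}$ for $n+1\le i\le 2n$. The Laplacian matrix $L$ of a simple graph on $[m]$ has $L_{ii}=\deg(i)$, $L_{ij}=-1$ if $\{i,j\}$ is an edge and $0$ otherwise; the Laplacian simplex is the convex hull in $\mathbb{R}^{m-1}$ of the rows of $L$ with its $m$-th column deleted. A lattice polytope is reflexive if it contains the origin in its interior and its dual $\{\mathbf{x}\mid\mathbf{x}\mathbf{y}^T\le1\ \forall\mathbf{y}\in\mathcal{P}\}$ is a lattice polytope. *)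

theory Defs
  imports "HOL-Analysis.Analysis"
begin

text \<open>A simple graph on the vertex set \<open>[m] = {1..m}\<close> is represented by its set of edges,
  each edge being a two-element subset of \<open>{1..m}\<close>.\<close>

definition complete_graph :: "nat \<Rightarrow> nat set set" where
  "complete_graph n = {{i, j} | i j. i \<in> {1..n} \<and> j \<in> {1..n} \<and> i \<noteq> j}"

text \<open>For a graph \<open>E\<close> on \<open>{1..n}\<close>, the edge set of the graph \<open>W*(E)\<close> on \<open>{1..2*n+1}\<close>.\<close>

definition whisker_star :: "nat \<Rightarrow> nat set set \<Rightarrow> nat set set" where
  "whisker_star n E =
     E \<union> {{i, i + n} | i. i \<in> {1..n}} \<union> {{i, 2 * n + 1} | i. i \<in> {n + 1..2 * n}}"

definition deg :: "nat set set \<Rightarrow> nat \<Rightarrow> nat" where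
  "deg E i = card {e \<in> E. i \<in> e}"

definition laplacian :: "nat set set \<Rightarrow> nat \<Rightarrow> nat \<Rightarrow> int" where
  "laplacian E i j = (if i = j then int (deg E i) else if {i, j} \<in> E then - 1 else 0)"

text \<open>The ambient space \<open>\<real>\<^sup>m\<^sup>-\<^sup>1\<close> is \<^typ>\<open>real ^ 'd\<close>, where \<open>idx\<close> is a bijection from the index type
  \<^typ>\<open>'d\<close> onto \<open>{1..m-1}\<close> that gives each coordinate its number. Only columns \<open>1, ..., m-1\<close>
  of the Laplacian are in the image of \<open>idx\<close>, so column \<open>m\<close> is deleted.\<close>

definition laplacian_simplex ::
    "('d::finite \<Rightarrow> nat) \<Rightarrow> nat \<Rightarrow> nat set set \<Rightarrow> (real ^ 'd) set" where
  "laplacian_simplex idx m E =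
     convex hull ((\<lambda>i. \<chi> k. real_of_int (laplacian E i (idx k))) ` {1..m})"

definition lattice_polytope :: "(real ^ 'd::finite) set \<Rightarrow> bool" where
  "lattice_polytope P \<longleftrightarrow>
     (\<exists>V. finite V \<and> (\<forall>v\<in>V. \<forall>k. v $ k \<in> \<int>) \<and> P = convex hull V)"

definition dual_polytope :: "(real ^ 'd::finite) set \<Rightarrow> (real ^ 'd) set" where
  "dual_polytope P = {x. \<forall>y\<in>P. x \<bullet> y \<le> 1}"

definition reflexive_polytope :: "(real ^ 'd::finite) set \<Rightarrow> bool" where
  "reflexive_polytope P \<longleftrightarrow>
     lattice_polytope P \<and> 0 \<in> interior P \<and> lattice_polytope (dual_polytope P)"

end

theory Submission
  imports Defs
begin

text \<open>Row sums of a Laplacian vanish, so the rows \<open>r\<^sub>1, \<dots>, r\<^sub>m\<close> without their last entry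
  sum to \<open>0\<close>. Suppose vectors \<open>w\<^sub>j\<close> satisfy \<open>r\<^sub>i \<bullet> w\<^sub>j = 1\<close> for \<open>i \<noteq> j\<close> and
  \<open>r\<^sub>j \<bullet> w\<^sub>j = 1 - m\<close>. Then \<open>x = \<Sum>\<^sub>j ((1 - x \<bullet> r\<^sub>j) / m) w\<^sub>j\<close> for every \<open>x\<close>, so the simplices
  spanned by the \<open>r\<^sub>i\<close> and by the \<open>w\<^sub>j\<close> are dual to each other. Padding \<open>w\<^sub>j\<close> by a last entry
  \<open>0\<close>, the condition reads \<open>L w\<^sub>j = 1 - m e\<^sub>j\<close>, and for \<open>W*(K\<^sub>n)\<close> this system has an explicit
  integral solution for every \<open>j\<close>.\<close>

section \<open>Dual pairs of simplices\<close>

text \<open>The equations for \<open>i \<noteq> j\<close> make \<open>w j\<close> the common point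
  of all the hyperplanes \<open>x \<bullet> r i = 1\<close> except that of \<open>r j\<close>; the
  diagonal value \<open>1 - card I\<close> fits \<open>sum r I = 0\<close>.\<close>

locale dual_simplices =
  fixes I :: "'i set" and r w :: "'i \<Rightarrow> 'a::euclidean_space"
  assumes fin: "finite I"
    and card_I: "card I = DIM('a) + 1"
    and sum_r: "sum r I = 0"
    and inner_rw: "\<And>i j. i \<in> I \<Longrightarrow> j \<in> I \<Longrightarrow> r i \<bullet> w j = 1 - (if i = j then real (card I) else 0)"
begin

lemma inj_r: "inj_on r I"
proof (rule inj_onI)
  fix i j assume ij: "i \<in> I" "j \<in> I" "r i = r j"
  show "i = j"
  proof (rule ccontr)
    assume "i \<noteq> j"
    then have "1 - real (card I) = 1"
      using inner_rw[of i i] inner_rw[of j i] ij by simp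
    then show False using card_I by simp
  qed
qed

text \<open>Without one of its members the family \<open>r\<close> has \<open>DIM('a)\<close>
  elements and is independent, so it spans the space and only \<open>0\<close> is orthogonal to
  it.\<close>

lemma orthogonal_rows_imp_zero:
  assumes x: "\<And>i. i \<in> I \<Longrightarrow> x \<bullet> r i = 0"
  shows "x = 0"
proof -
  obtain k where k: "k \<in> I" using card_I by fastforce
  define J where "J = I - {k}"
  have J: "finite J" "J \<subseteq> I" "card J = DIM('a)" "k \<notin> J"
    using fin card_I k by (auto simp: J_def)
  have inj: "inj_on r J" using inj_r J(2) by (rule inj_on_subset)
  have "independent (r ` J)"
  proof (rule independent_if_scalars_zero)
    fix c y assume c: "(\<Sum>x\<in>r ` J. c x *\<^sub>R x) = 0" and "y \<in> r ` J"
    then obtain j where j: "j \<in> J" "y = r j" by blast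
    have 0: "(\<Sum>i\<in>J. c (r i) *\<^sub>R r i) = 0"
      using c by (simp add: sum.reindex[OF inj])
    \<comment> \<open>Pairing the linear relation with \<open>w l\<close> picks out the single
      coefficient \<open>c (r l)\<close> against the sum of all coefficients.\<close>
    have eq: "(\<Sum>i\<in>J. c (r i)) = (if l \<in> J then real (card I) * c (r l) else 0)"
      if l: "l \<in> I" for l
    proof -
      have "0 = (\<Sum>i\<in>J. c (r i) *\<^sub>R r i) \<bullet> w l" using 0 by simp
      also have "\<dots> = (\<Sum>i\<in>J. c (r i) - (if i = l then real (card I) * c (r i) else 0))"
        unfolding inner_sum_left
        by (rule sum.cong) (use l J in \<open>auto simp: inner_rw algebra_simps\<close>)
      also have "\<dots> = (\<Sum>i\<in>J. c (r i)) - (if l \<in> J then real (card I) * c (r l) else 0)"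
        using J(1) by (simp add: sum_subtractf)
      finally show ?thesis by simp
    qed
    \<comment> \<open>The omitted index \<open>k\<close> shows that the coefficient sum is
      \<open>0\<close>; then the index \<open>j\<close> isolates \<open>c (r j)\<close>.\<close>
    have "real (card I) * c (r j) = 0"
      using eq[OF k] eq[of j] j J by auto
    then show "c y = 0" using j card_I by simp
  qed (use J in simp)
  then have "(UNIV :: 'a set) \<subseteq> span (r ` J)"
    by (rule card_ge_dim_independent[rotated]) (use J inj in \<open>auto simp: card_image\<close>)
  then have "x \<in> span (r ` J)" by blast
  moreover have "orthogonal x y" if "y \<in> r ` J" for y
    using that x J by (auto simp: orthogonal_def)
  ultimately have "orthogonal x x"
    by (rule orthogonal_to_span)
  then show ?thesis by (simp add: orthogonal_def)
qed

text \<open>The coefficients add up to 1 because \<open>r\<close> sums to \<open>0\<close>. The two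
  sides of the expansion have the same inner product with every \<open>r i\<close>, hence
  coincide.\<close>

lemma barycentric_expansion:
  "x = (\<Sum>j\<in>I. ((1 - x \<bullet> r j) / real (card I)) *\<^sub>R w j)"
  "(\<Sum>j\<in>I. (1 - x \<bullet> r j) / real (card I)) = 1"
proof -
  have m: "real (card I) \<noteq> 0" using card_I by simp
  have "(\<Sum>j\<in>I. 1 - x \<bullet> r j) = real (card I)"
    by (simp add: sum_subtractf sum_r flip: inner_sum_right)
  then show one: "(\<Sum>j\<in>I. (1 - x \<bullet> r j) / real (card I)) = 1"
    using m by (simp flip: sum_divide_distrib)
  have "x - (\<Sum>j\<in>I. ((1 - x \<bullet> r j) / real (card I)) *\<^sub>R w j) = 0"
  proof (rule orthogonal_rows_imp_zero)
    fix i assume i: "i \<in> I"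
    have "(\<Sum>j\<in>I. ((1 - x \<bullet> r j) / real (card I)) *\<^sub>R w j) \<bullet> r i
        = (\<Sum>j\<in>I. (1 - x \<bullet> r j) / real (card I) - (if i = j then 1 - x \<bullet> r j else 0))"
      unfolding inner_sum_left
      by (rule sum.cong) (use i m in \<open>auto simp: inner_rw inner_commute[of _ "r i"] field_simps\<close>)
    also have "\<dots> = x \<bullet> r i"
      using i fin by (simp add: sum_subtractf one)
    finally show "(x - (\<Sum>j\<in>I. ((1 - x \<bullet> r j) / real (card I)) *\<^sub>R w j)) \<bullet> r i = 0"
      by (simp add: inner_diff_left)
  qed
  then show "x = (\<Sum>j\<in>I. ((1 - x \<bullet> r j) / real (card I)) *\<^sub>R w j)" by simp
qed

text \<open>The inequalities say exactly that the barycentric coefficients of \<open>x\<close> are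
  nonnegative. Conversely each \<open>w j\<close> satisfies them, and they cut out a convex
  set.\<close>

lemma halfspaces_eq_hull: "{x. \<forall>i\<in>I. x \<bullet> r i \<le> 1} = convex hull (w ` I)"
proof
  show "{x. \<forall>i\<in>I. x \<bullet> r i \<le> 1} \<subseteq> convex hull (w ` I)"
  proof
    fix x assume x: "x \<in> {x. \<forall>i\<in>I. x \<bullet> r i \<le> 1}"
    have "(\<Sum>j\<in>I. ((1 - x \<bullet> r j) / real (card I)) *\<^sub>R w j) \<in> convex hull (w ` I)"
      using x fin
      by (intro convex_sum barycentric_expansion(2)) (auto intro: hull_inc)
    then show "x \<in> convex hull (w ` I)"
      using barycentric_expansion(1)[of x] by simp
  qed
  have "convex {x. \<forall>i\<in>I. x \<bullet> r i \<le> 1}"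
  proof -
    have "{x. \<forall>i\<in>I. x \<bullet> r i \<le> 1} = (\<Inter>i\<in>I. {x. r i \<bullet> x \<le> 1})"
      by (auto simp: inner_commute)
    then show ?thesis by (auto intro!: convex_INT convex_halfspace_le)
  qed
  moreover have "w ` I \<subseteq> {x. \<forall>i\<in>I. x \<bullet> r i \<le> 1}"
    by (auto simp: inner_commute[of "w _"] inner_rw)
  ultimately show "convex hull (w ` I) \<subseteq> {x. \<forall>i\<in>I. x \<bullet> r i \<le> 1}"
    by (rule hull_minimal[rotated])
qed

text \<open>The pairing is symmetric in \<open>r\<close> and \<open>w\<close>; only
  \<open>sum w I = 0\<close> has to be shown, and this sum pairs to \<open>0\<close> with every
  \<open>r i\<close>.\<close>

lemma dual_simplices_swap: "dual_simplices I w r"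
proof
  have "sum w I \<bullet> r i = 0" if "i \<in> I" for i
    using that fin
    by (simp add: inner_sum_left inner_commute[of "w _"] inner_rw sum_subtractf)
  then show "sum w I = 0" by (rule orthogonal_rows_imp_zero)
qed (auto simp: fin card_I inner_rw inner_commute[of "w _"])

text \<open>With the roles exchanged, the hull of \<open>r\<close> is cut out by the inequalities
  \<open>x \<bullet> w i \<le> 1\<close>; their strict versions define an open neighbourhood of
  \<open>0\<close> inside it.\<close>

lemma zero_in_interior_hull: "0 \<in> interior (convex hull (r ` I))"
proof (rule interiorI)
  have "{x. \<forall>i\<in>I. x \<bullet> w i < 1} = (\<Inter>i\<in>I. {x. w i \<bullet> x < 1})"
    by (auto simp: inner_commute)
  then show "open {x. \<forall>i\<in>I. x \<bullet> w i < 1}"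
    using fin by (auto intro!: open_INT open_halfspace_lt)
  show "{x. \<forall>i\<in>I. x \<bullet> w i < 1} \<subseteq> convex hull (r ` I)"
    unfolding dual_simplices.halfspaces_eq_hull[OF dual_simplices_swap, symmetric] by force
qed simp

end

text \<open>A half-space is convex, so a linear bound that holds on \<open>S\<close> extends to its
  hull.\<close>

lemma dual_polytope_convex_hull:
  "dual_polytope (convex hull S) = {x. \<forall>y\<in>S. x \<bullet> y \<le> 1}"
proof
  show "{x. \<forall>y\<in>S. x \<bullet> y \<le> 1} \<subseteq> dual_polytope (convex hull S)"
  proof
    fix x assume "x \<in> {x. \<forall>y\<in>S. x \<bullet> y \<le> 1}"
    then have "convex hull S \<subseteq> {y. x \<bullet> y \<le> 1}"
      by (intro hull_minimal convex_halfspace_le) auto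
    then show "x \<in> dual_polytope (convex hull S)"
      by (auto simp: dual_polytope_def)
  qed
qed (auto simp: dual_polytope_def hull_inc)

text \<open>Since the dual is the hull of \<open>w\<close>, reflexivity comes down to exhibiting
  integral vectors \<open>w\<close>.\<close>

lemma reflexive_polytope_if_dual_simplices:
  fixes r w :: "'i \<Rightarrow> real ^ 'd::finite"
  assumes "dual_simplices I r w"
    and "\<And>i k. i \<in> I \<Longrightarrow> r i $ k \<in> \<int>" "\<And>i k. i \<in> I \<Longrightarrow> w i $ k \<in> \<int>"
  shows "reflexive_polytope (convex hull (r ` I))"
proof -
  interpret dual_simplices I r w by fact
  have "dual_polytope (convex hull (r ` I)) = convex hull (w ` I)"
    using halfspaces_eq_hull by (simp add: dual_polytope_convex_hull)
  moreover have "lattice_polytope (convex hull (u ` I))"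
    if "\<And>i k. i \<in> I \<Longrightarrow> u i $ k \<in> \<int>" for u :: "'i \<Rightarrow> real ^ 'd"
    unfolding lattice_polytope_def using that fin by (intro exI[of _ "u ` I"]) auto
  ultimately show ?thesis
    using assms by (simp add: reflexive_polytope_def zero_in_interior_hull)
qed

section \<open>Laplacians\<close>

definition neighbours :: "nat set set \<Rightarrow> nat \<Rightarrow> nat set" where
  "neighbours E i = {v. v \<noteq> i \<and> {i, v} \<in> E}"

lemma deg_eq_card_neighbours:
  assumes "\<And>e. e \<in> E \<Longrightarrow> card e = 2"
  shows "deg E i = card (neighbours E i)"
proof -
  have "bij_betw (\<lambda>v. {i, v}) (neighbours E i) {e \<in> E. i \<in> e}"
  proof (rule bij_betwI')
    fix e assume "e \<in> {e \<in> E. i \<in> e}"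
    then obtain a b where "e = {a, b}" "a \<noteq> b" "e \<in> E" "i \<in> e"
      using assms by (force simp: card_2_iff)
    then show "\<exists>v\<in>neighbours E i. e = {i, v}"
      by (auto simp: neighbours_def insert_commute)
  qed (auto simp: neighbours_def doubleton_eq_iff)
  then show ?thesis by (simp add: deg_def bij_betw_same_card)
qed

text \<open>The diagonal term \<open>deg E i * f i\<close> contributes one copy of
  \<open>f i\<close> per neighbour, which turns a row of the matrix into a sum of differences along
  edges.\<close>

lemma laplacian_mult_vec:
  assumes "\<And>e. e \<in> E \<Longrightarrow> card e = 2" and "finite V" "i \<in> V" "neighbours E i \<subseteq> V"
  shows "(\<Sum>v\<in>V. laplacian E i v * f v) = (\<Sum>v\<in>neighbours E i. f i - f v)"
proof -
  have fin: "finite (neighbours E i)" using assms finite_subset by blast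
  have "(\<Sum>v\<in>V. laplacian E i v * f v)
      = (\<Sum>v\<in>V. (if i = v then int (deg E i) * f i else 0) - (if v \<in> neighbours E i then f v else 0))"
    by (rule sum.cong) (auto simp: laplacian_def neighbours_def)
  also have "\<dots> = int (deg E i) * f i - (\<Sum>v\<in>V \<inter> neighbours E i. f v)"
    using assms by (simp add: sum_subtractf sum.inter_restrict)
  also have "V \<inter> neighbours E i = neighbours E i" using assms by blast
  finally show ?thesis
    using deg_eq_card_neighbours[of E i, OF assms(1)] fin by (simp add: sum_subtractf)
qed

lemma laplacian_commute: "laplacian E i j = laplacian E j i"
  by (simp add: laplacian_def insert_commute)

section \<open>The graph \<open>W*(K\<^sub>n)\<close>\<close>

abbreviation whisker_complete :: "nat \<Rightarrow> nat set set" where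
  "whisker_complete n \<equiv> whisker_star n (complete_graph n)"

lemma whisker_complete_card_edge: "e \<in> whisker_complete n \<Longrightarrow> card e = 2"
  by (auto simp: whisker_star_def complete_graph_def)

lemma doubleton_in_complete_graph_iff:
  "{i, j} \<in> complete_graph n \<longleftrightarrow> i \<in> {1..n} \<and> j \<in> {1..n} \<and> i \<noteq> j"
  unfolding complete_graph_def by (blast dest: doubleton_eq_iff[THEN iffD1])

lemma neighbours_whisker_complete:
  "i \<in> {1..n} \<Longrightarrow> neighbours (whisker_complete n) i = insert (i + n) ({1..n} - {i})"
  "i \<in> {1..n} \<Longrightarrow> neighbours (whisker_complete n) (i + n) = {i, 2 * n + 1}"
  "neighbours (whisker_complete n) (2 * n + 1) = {n + 1..2 * n}"
  by (auto simp: neighbours_def whisker_star_def doubleton_in_complete_graph_iff doubleton_eq_iff)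

lemma whisker_complete_vertex_cases:
  fixes i n :: nat
  assumes "i \<in> {1..2 * n + 1}"
  obtains (clique) "i \<in> {1..n}" | (whisker) k where "k \<in> {1..n}" "i = k + n" | (apex) "i = 2 * n + 1"
proof -
  consider "i \<le> n" | "n < i" "i \<le> 2 * n" | "i = 2 * n + 1" using assms by force
  then show thesis
  proof cases
    case 2
    then have "i - n \<in> {1..n}" "i = (i - n) + n" by auto
    then show thesis by (rule whisker)
  qed (use assms clique apex in auto)
qed

lemma neighbours_whisker_complete_subset:
  "i \<in> {1..2 * n + 1} \<Longrightarrow> neighbours (whisker_complete n) i \<subseteq> {1..2 * n + 1}"
  by (cases rule: whisker_complete_vertex_cases[of i n])
    (auto simp: neighbours_whisker_complete simp del: One_nat_def)

text \<open>The three cases of \<open>j\<close> solve \<open>L x = 1 - (2 n + 1) e\<^sub>j\<close> with last entry \<open>x\<^sub>2\<^sub>n\<^sub>+\<^sub>1 = 0\<close>.\<close>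

definition dual_vertex :: "nat \<Rightarrow> nat \<Rightarrow> nat \<Rightarrow> int" where
  "dual_vertex n j v =
     (if v = 2 * n + 1 then 0
      else if j \<le> n then
        (if v \<le> n then - 1 - (if v = j then 2 else 0) else - (if v = j + n then 1 else 0))
      else if j \<le> 2 * n then
        (if v \<le> n then 1 - (if v + n = j then 1 else 0) else 1 - (if v = j then int n + 1 else 0))
      else (if v \<le> n then 3 else 2))"

lemma sum_neighbours_whisker_complete:
  fixes f :: "nat \<Rightarrow> int"
  shows "i \<in> {1..n} \<Longrightarrow> (\<Sum>v\<in>neighbours (whisker_complete n) i. f i - f v)
      = int (n + 1) * f i - (\<Sum>v=1..n. f v) - f (i + n)"
    and "i \<in> {1..n} \<Longrightarrow> (\<Sum>v\<in>neighbours (whisker_complete n) (i + n). f (i + n) - f v)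
      = 2 * f (i + n) - f i - f (2 * n + 1)"
    and "(\<Sum>v\<in>neighbours (whisker_complete n) (2 * n + 1). f (2 * n + 1) - f v)
      = int n * f (2 * n + 1) - (\<Sum>v=1..n. f (v + n))"
proof -
  assume i: "i \<in> {1..n}"
  \<comment> \<open>The term \<open>v = i\<close> vanishes and can be put back; hence the factor
    \<open>n + 1\<close>, although a clique vertex has degree \<open>n\<close>.\<close>
  have "(\<Sum>v\<in>{1..n} - {i}. f i - f v) = (\<Sum>v=1..n. f i - f v)"
    using i by (simp add: sum_diff1)
  then show "(\<Sum>v\<in>neighbours (whisker_complete n) i. f i - f v)
      = int (n + 1) * f i - (\<Sum>v=1..n. f v) - f (i + n)"
    using i by (simp add: neighbours_whisker_complete sum_subtractf algebra_simps)
next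
  assume "i \<in> {1..n}"
  then show "(\<Sum>v\<in>neighbours (whisker_complete n) (i + n). f (i + n) - f v)
      = 2 * f (i + n) - f i - f (2 * n + 1)"
    by (simp add: neighbours_whisker_complete)
next
  have "(\<Sum>v=n+1..2*n. f v) = (\<Sum>v=1..n. f (v + n))"
    using sum.shift_bounds_cl_nat_ivl[of f 1 n n] by (simp add: mult_2 add.commute)
  then show "(\<Sum>v\<in>neighbours (whisker_complete n) (2 * n + 1). f (2 * n + 1) - f v)
      = int n * f (2 * n + 1) - (\<Sum>v=1..n. f (v + n))"
    by (simp only: neighbours_whisker_complete sum_subtractf) simp
qed

lemma laplacian_mult_dual_vertex:
  assumes i: "i \<in> {1..2 * n + 1}" and j: "j \<in> {1..2 * n + 1}"
  shows "(\<Sum>v\<in>{1..2 * n + 1}. laplacian (whisker_complete n) i v * dual_vertex n j v)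
       = 1 - (if i = j then int (2 * n + 1) else 0)"
proof -
  let ?W = "dual_vertex n j"
  \<comment> \<open>The sums over the clique and over the whisker ends are the only nonlocal
    quantities in the rows, so they are computed once for each type of \<open>j\<close>.\<close>
  have "(\<Sum>v=1..n. ?W v) =
      (if j \<le> n then - int n - 2 else if j \<le> 2 * n then int n - 1 else 3 * int n) \<and>
    (\<Sum>v=1..n. ?W (v + n)) = (if j \<le> 2 * n then - 1 else 2 * int n)"
    using j
  proof (cases rule: whisker_complete_vertex_cases)
    case clique
    then have "(\<Sum>v=1..n. ?W v) = (\<Sum>v=1..n. - 1 - (if v = j then 2 else 0))"
      "(\<Sum>v=1..n. ?W (v + n)) = (\<Sum>v=1..n. - (if v = j then 1 else 0))"
      by (auto intro!: sum.cong simp: dual_vertex_def)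
    then show ?thesis
      using clique by (simp add: sum_subtractf sum_negf)
  next
    case (whisker k)
    then have "(\<Sum>v=1..n. ?W v) = (\<Sum>v=1..n. 1 - (if v = k then 1 else 0))"
      "(\<Sum>v=1..n. ?W (v + n)) = (\<Sum>v=1..n. 1 - (if v = k then int n + 1 else 0))"
      by (auto intro!: sum.cong simp: dual_vertex_def)
    then show ?thesis
      using whisker by (simp add: sum_subtractf)
  next
    case apex
    then have "(\<Sum>v=1..n. ?W v) = (\<Sum>v=1..n. 3)" "(\<Sum>v=1..n. ?W (v + n)) = (\<Sum>v=1..n. 2)"
      by (auto intro!: sum.cong simp: dual_vertex_def)
    then show ?thesis
      using apex by simp
  qed
  note sums = this[THEN conjunct1] this[THEN conjunct2]
  have "(\<Sum>v\<in>{1..2 * n + 1}. laplacian (whisker_complete n) i v * ?W v)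
      = (\<Sum>v\<in>neighbours (whisker_complete n) i. ?W i - ?W v)"
    using i by (intro laplacian_mult_vec neighbours_whisker_complete_subset)
      (auto dest: whisker_complete_card_edge)
  also have "\<dots> = 1 - (if i = j then int (2 * n + 1) else 0)"
    using i
  proof (cases rule: whisker_complete_vertex_cases)
    case clique
    then show ?thesis
      unfolding sum_neighbours_whisker_complete(1)[OF clique] sums
      using j by (auto simp: dual_vertex_def algebra_simps)
  next
    case (whisker k)
    then show ?thesis
      unfolding whisker(2) sum_neighbours_whisker_complete(2)[OF whisker(1)]
      using j by (auto simp: dual_vertex_def algebra_simps)
  next
    case apex
    then show ?thesis
      unfolding apex sum_neighbours_whisker_complete(3) sums
      using j by (auto simp: dual_vertex_def)
  qed
  finally show ?thesis .
qed

text \<open>By symmetry this is a row sum, that is, the Laplacian applied to the constant 1, whose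
  differences along edges vanish.\<close>

lemma laplacian_whisker_complete_column_sum:
  assumes "v \<in> {1..2 * n + 1}"
  shows "(\<Sum>i\<in>{1..2 * n + 1}. laplacian (whisker_complete n) i v) = 0"
proof -
  have "(\<Sum>i\<in>{1..2 * n + 1}. laplacian (whisker_complete n) v i * 1) = 0"
    by (subst laplacian_mult_vec)
      (use assms neighbours_whisker_complete_subset whisker_complete_card_edge in auto)
  then show ?thesis by (simp only: laplacian_commute[of _ v] mult_1_right)
qed

theorem theorem3p25:
  fixes n :: nat and idx :: "'d::finite \<Rightarrow> nat"
  assumes "n \<ge> 3"
    and "bij_betw idx (UNIV :: 'd set) {1..2 * n}"
  shows "reflexive_polytope
           (laplacian_simplex idx (2 * n + 1) (whisker_star n (complete_graph n)))"
proof -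
  let ?L = "laplacian (whisker_complete n)" and ?I = "{1..2 * n + 1}"
  define r :: "nat \<Rightarrow> real ^ 'd" where "r i = (\<chi> k. real_of_int (?L i (idx k)))" for i
  define w :: "nat \<Rightarrow> real ^ 'd" where "w j = (\<chi> k. real_of_int (dual_vertex n j (idx k)))" for j
  have card_d: "CARD('d) = 2 * n"
    using bij_betw_same_card[OF assms(2)] by simp
  have idx: "idx k \<in> {1..2 * n}" for k
    using assms(2) by (auto simp: bij_betw_def)
  have "dual_simplices ?I r w"
  proof
    show "sum r ?I = 0"
    proof (rule vec_eq_iff[THEN iffD2], rule allI)
      fix k
      have "idx k \<in> ?I" using idx[of k] by auto
      then have "real_of_int (\<Sum>i\<in>?I. ?L i (idx k)) = 0"
        by (simp only: laplacian_whisker_complete_column_sum of_int_0)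
      then show "sum r ?I $ k = 0 $ k"
        by (simp only: sum_component r_def vec_lambda_beta of_int_sum zero_index)
    qed
    fix i j assume ij: "i \<in> ?I" "j \<in> ?I"
    have "r i \<bullet> w j = (\<Sum>k\<in>UNIV. real_of_int (?L i (idx k) * dual_vertex n j (idx k)))"
      by (simp add: inner_vec_def r_def w_def)
    also have "\<dots> = (\<Sum>v\<in>{1..2 * n}. real_of_int (?L i v * dual_vertex n j v))"
      using assms(2) by (rule sum.reindex_bij_betw)
    \<comment> \<open>The deleted column can be restored because \<open>dual_vertex n j\<close> is
      \<open>0\<close> at \<open>2 * n + 1\<close>.\<close>
    also have "\<dots> = real_of_int (\<Sum>v\<in>?I. ?L i v * dual_vertex n j v)"
      by (simp add: dual_vertex_def)
    also have "\<dots> = 1 - (if i = j then real (card ?I) else 0)"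
      unfolding laplacian_mult_dual_vertex[OF ij] by simp
    finally show "r i \<bullet> w j = 1 - (if i = j then real (card ?I) else 0)" .
  qed (simp_all add: card_d)
  then have "reflexive_polytope (convex hull (r ` ?I))"
    by (rule reflexive_polytope_if_dual_simplices) (simp_all add: r_def w_def)
  then show ?thesis
    by (simp add: laplacian_simplex_def r_def[abs_def])
qed

end
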